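(* Let $G$ be a finite group acting linearly on $\mathbb{R}^n$, let $K\subset\mathbb{R}^n$ be convex and $G$-invariant, and let $$f(x)=\sum_{\alpha\in\mathcal{A}}c_\alpha\exp(\langle\alpha,x\rangle)+\sum_{\beta\in\mathcal{B}}c_\beta\exp(\langle\beta,x\rangle)$$ be a $G$-invariant signomial, where $\emptyset\neq\mathcal{A}\subset\mathbb{R}^n$ and $\mathcal{B}\subset\mathbb{R}^n$ are disjoint finite sets, $c_\alpha>0$ for all $\alpha\in\mathcal{A}$ and $c_\beta<0$ for all $\beta\in\mathcal{B}$. Let $\hat{\mathcal{B}}$ be a set of orbit representatives for $\mathcal{B}$. Then $f\in C_K(\mathcal{A},\mathcal{B})$ if and only if for every $\hat\beta\in\hat{\mathcal{B}}$ there exists a $K$-AGE signomial $h_{\hat\beta}\in C_K(\mathcal{A},\hat\beta)$ such that $$f=\sum_{\hat\beta\in\hat{\mathcal{B}}}\ \sum_{\rho\in G/\mathrm{Stab}(\hat\beta)}\rho\, h_{\hat\beta}.$$ Moreover, the functions $h_{\hat\beta}$ can be chosen to be invariant under the action of $\mathrm{Stab}(\hat\beta)$.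
   Context: Actions. $G$ acts linearly on $\mathbb{R}^n$ (the space of variables) on the left via a homomorphism $\varphi:G\to\mathrm{GL}_n(\mathbb{R})$, $\sigma(x)=\varphi(\sigma)(x)$. It acts on functions on $\mathbb{R}^n$ by $(\sigma f)(x)=f(\sigma^{-1}(x))$, and on exponent vectors $\alpha\in\mathbb{R}^n$ by the dual action $\sigma(\alpha)=\varphi(\sigma^{-1})^{\#}(\alpha)$, where $A^{\#}$ is the adjoint of $A$ with respect to the standard Euclidean inner product $\langle\cdot,\cdot\rangle$. Thus $\sigma$ maps $\sum_\alpha c_\alpha e^{\langle\alpha,x\rangle}$ to $\sum_\alpha c_\alpha e^{\langle\sigma(\alpha),x\rangle}$. A $G$-invariant $f$ satisfies $\sigma f=f$ for all $\sigma\in G$ (so, because of the sign conditions on coefficients, $\mathcal{A}$ and $\mathcal{B}$ are $G$-stable sets of exponents). $K$ is $G$-invariant with respect to the action on variables. Orbit representatives. For a $G$-stable set $\mathcal{S}$ of exponent vectors, a set of orbit representatives is an inclusion-minimal subset $\hat{\mathcal{S}}\subset\mathcal{S}$ with $G\cdot\hat{\mathcal{S}}=\mathcal{S}$, i.e. it contains exactly one element of each orbit. $\mathrm{Stab}(\beta)=\{\sigma\in G:\sigma(\beta)=\beta\}$ (dual action). The notation $\rho\in G/\mathrm{Stab}(\hat\beta)$ means that $\rho$ runs over a set of representatives of the left cosets $\sigma\,\mathrm{Stab}(\hat\beta)$, $\sigma\in G$. Cones. A signomial is a finite sum $\sum_\alpha c_\alpha e^{\langle\alpha,x\rangle}$ with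 real coefficients. For a nonempty finite set $\mathcal{A}\subset\mathbb{R}^n$ and $\beta\in\mathbb{R}^n\setminus\mathcal{A}$, $$C_K(\mathcal{A},\beta)=\Big\{\sum_{\alpha\in\mathcal{A}}c_\alpha e^{\langle\alpha,x\rangle}+c_\beta e^{\langle\beta,x\rangle}\ :\ c_\alpha\ge0\ (\alpha\in\mathcal{A}),\ c_\beta\in\mathbb{R},\ \text{the function is }\ge0\text{ on }K\Big\};$$ its elements are called $K$-AGE signomials. For disjoint finite sets $\mathcal{A}\neq\emptyset$ and $\mathcal{B}$, the signed $K$-SAGE cone is the Minkowski sum $C_K(\mathcal{A},\mathcal{B})=\sum_{\beta\in\mathcal{B}}C_K(\mathcal{A},\beta)$. *)

theory Defs
  imports
    "HOL-Analysis.Analysis"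
    "HOL-Algebra.Left_Coset"
    "HOL-Algebra.Group_Action"
    "HOL-Library.Set_Algebras"
    "HOL-Library.Function_Algebras"
begin

text \<open>
  Sums of functions are pointwise (Function_Algebras), and sums of sets of functions are
  Minkowski sums (Set_Algebras); an empty Minkowski sum is the set containing only the zero
  function.
\<close>

definition GL :: "(real ^ 'n ^ 'n) monoid"
  where "GL = \<lparr>carrier = {M. invertible M}, mult = (**), one = mat 1\<rparr>"

lemma group_GL: "group (GL :: (real ^ 'n ^ 'n) monoid)"
proof (rule groupI)
  fix M :: "real ^ 'n ^ 'n"
  assume "M \<in> carrier GL"
  then obtain N where "M ** N = mat 1" "N ** M = mat 1"
    by (auto simp: GL_def invertible_def)
  then show "\<exists>N\<in>carrier GL. N \<otimes>\<^bsub>GL\<^esub> M = \<one>\<^bsub>GL\<^esub>"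
    by (auto simp: GL_def invertible_def)
qed (auto simp: GL_def matrix_mul_assoc invertible_mult invertible_def[of "mat 1"])

definition var_act :: "('g \<Rightarrow> real ^ 'n ^ 'n) \<Rightarrow> 'g \<Rightarrow> real ^ 'n \<Rightarrow> real ^ 'n"
  where "var_act \<phi> \<sigma> x = \<phi> \<sigma> *v x"

definition fun_act ::
    "('g, 'e) monoid_scheme \<Rightarrow> ('g \<Rightarrow> real ^ 'n ^ 'n) \<Rightarrow> 'g \<Rightarrow> (real ^ 'n \<Rightarrow> real) \<Rightarrow> real ^ 'n \<Rightarrow> real"
  where "fun_act G \<phi> \<sigma> f = (\<lambda>x. f (var_act \<phi> (inv\<^bsub>G\<^esub> \<sigma>) x))"

definition dual_act ::
    "('g, 'e) monoid_scheme \<Rightarrow> ('g \<Rightarrow> real ^ 'n ^ 'n) \<Rightarrow> 'g \<Rightarrow> real ^ 'n \<Rightarrow> real ^ 'n"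
  where "dual_act G \<phi> \<sigma> \<alpha> = adjoint (var_act \<phi> (inv\<^bsub>G\<^esub> \<sigma>)) \<alpha>"

definition signomial :: "(real ^ 'n) set \<Rightarrow> (real ^ 'n \<Rightarrow> real) \<Rightarrow> real ^ 'n \<Rightarrow> real"
  where "signomial S c = (\<lambda>x. \<Sum>\<alpha>\<in>S. c \<alpha> * exp (\<alpha> \<bullet> x))"

text \<open>Meaningful for finite nonempty \<open>A\<close> and \<open>\<beta> \<notin> A\<close>.\<close>

definition age_cone :: "(real ^ 'n) set \<Rightarrow> (real ^ 'n) set \<Rightarrow> real ^ 'n \<Rightarrow> (real ^ 'n \<Rightarrow> real) set"
  where "age_cone K A \<beta> =
    {f. (\<exists>c d. (\<forall>\<alpha>\<in>A. c \<alpha> \<ge> 0) \<and> f = (\<lambda>x. signomial A c x + d * exp (\<beta> \<bullet> x))) \<and>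
        (\<forall>x\<in>K. f x \<ge> 0)}"

definition sage_cone :: "(real ^ 'n) set \<Rightarrow> (real ^ 'n) set \<Rightarrow> (real ^ 'n) set \<Rightarrow> (real ^ 'n \<Rightarrow> real) set"
  where "sage_cone K A B = (\<Sum>\<beta>\<in>B. age_cone K A \<beta>)"

definition orbit_reps :: "('g, 'e) monoid_scheme \<Rightarrow> ('g \<Rightarrow> 'v \<Rightarrow> 'v) \<Rightarrow> 'v set \<Rightarrow> 'v set \<Rightarrow> bool"
  where "orbit_reps G act S S' \<longleftrightarrow>
    S' \<subseteq> S \<and> (\<Union>s\<in>S'. orbit G act s) = S \<and>
    (\<forall>T. T \<subset> S' \<longrightarrow> (\<Union>s\<in>T. orbit G act s) \<noteq> S)"

definition lcoset_reps :: "('g, 'e) monoid_scheme \<Rightarrow> 'g set \<Rightarrow> 'g set \<Rightarrow> bool"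
  where "lcoset_reps G H R \<longleftrightarrow>
    R \<subseteq> carrier G \<and> (\<forall>C\<in>lcosets\<^bsub>G\<^esub> H. \<exists>!\<rho>. \<rho> \<in> R \<inter> C)"

end

theory Submission
  imports Defs
begin

text \<open>
  Linear independence of exponentials shows that an invariant signomial has a stable set of
  exponents with positive coefficients, so \<open>\<sigma>\<close> maps \<open>C\<^sub>K(A, \<beta>)\<close> to \<open>C\<^sub>K(A, \<sigma>(\<beta>))\<close>. Given a
  decomposition \<open>f = \<Sum>\<beta>\<in>B. g \<beta>\<close>, the averages
  \<open>k \<beta> = (1/|G|) \<Sum>\<sigma>\<in>G. \<sigma> (g (\<sigma>\<inverse>(\<beta>)))\<close> again sum to \<open>f\<close> and satisfy \<open>\<tau> (k \<beta>) = k (\<tau>(\<beta>))\<close>.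
  Since \<open>(\<beta>, \<rho>) \<mapsto> \<rho>(\<beta>)\<close> is a bijection from pairs of representatives onto \<open>B\<close>, restricting
  \<open>k\<close> to the representatives gives the symmetric decomposition.
\<close>

section \<open>Linear independence of exponentials\<close>

lemma sum_fun_app: "(\<Sum>i\<in>I. F i) x = (\<Sum>i\<in>I. F i x)"
  for F :: "'i \<Rightarrow> 'a \<Rightarrow> 'b::comm_monoid_add"
  by (induction I rule: infinite_finite_induct) auto

text \<open>Induction on the number of exponents: a translation eliminates one exponent and leaves a
  vanishing signomial on the smaller set, whose coefficients are those of \<open>c\<close> times
  explicit factors.\<close>

lemma signomial_eq_zero_imp_coeff_zero:
  assumes "finite S" "\<And>x. signomial S c x = 0" "\<alpha> \<in> S"
  shows "c \<alpha> = 0"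
  using assms
proof (induction S arbitrary: c \<alpha> rule: finite_induct)
  case empty
  then show ?case by simp
next
  case (insert \<beta> S)
  have expand: "signomial (insert \<beta> S) c x = c \<beta> * exp (\<beta> \<bullet> x) + signomial S c x" for x
    using insert.hyps by (simp add: signomial_def)
  have S0: "c \<gamma> = 0" if \<gamma>: "\<gamma> \<in> S" for \<gamma>
  proof -
    \<comment> \<open>With this shift the exponents satisfy (\<gamma> - \<beta>) \<bullet> y =
      |\<gamma> - \<beta>|^2 > 0, so the factor multiplying \<open>c \<gamma>\<close> after the
      elimination is nonzero.\<close>
    define y where "y = \<gamma> - \<beta>"
    \<comment> \<open>Subtracting \<open>exp (\<beta> \<bullet> y)\<close> times the identity at \<open>x\<close> from the identity at \<open>x + y\<close>
      eliminates the exponent \<open>\<beta>\<close>.\<close>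
    have "signomial S (\<lambda>\<alpha>. c \<alpha> * (exp (\<alpha> \<bullet> y) - exp (\<beta> \<bullet> y))) x = 0" for x
    proof -
      have "signomial S (\<lambda>\<alpha>. c \<alpha> * (exp (\<alpha> \<bullet> y) - exp (\<beta> \<bullet> y))) x
          = signomial S c (x + y) - exp (\<beta> \<bullet> y) * signomial S c x"
        by (simp add: signomial_def sum_distrib_left sum_subtractf[symmetric] inner_add_right
            exp_add algebra_simps)
      also have "\<dots> = signomial (insert \<beta> S) c (x + y)
          - exp (\<beta> \<bullet> y) * signomial (insert \<beta> S) c x"
        unfolding expand by (simp add: inner_add_right exp_add algebra_simps)
      finally show ?thesis
        using insert.prems(1) by simp
    qed
    then have "c \<gamma> * (exp (\<gamma> \<bullet> y) - exp (\<beta> \<bullet> y)) = 0"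
      using insert.IH[of "\<lambda>\<alpha>. c \<alpha> * (exp (\<alpha> \<bullet> y) - exp (\<beta> \<bullet> y))" \<gamma>] \<gamma> by blast
    moreover have "(\<gamma> - \<beta>) \<bullet> y \<noteq> 0"
      using \<gamma> insert.hyps by (auto simp: y_def)
    ultimately show ?thesis
      by (simp add: inner_diff_left)
  qed
  \<comment> \<open>Only the \<beta>-term survives; evaluating at the origin isolates its
    coefficient.\<close>
  then have "c \<beta> = 0"
    using insert.prems(1)[of 0] expand[of 0] by (simp add: signomial_def)
  with S0 insert.prems(2) show ?case by auto
qed

text \<open>The difference of the two signomials, with coefficients extended by zero to
  \<open>S \<union> T\<close>, vanishes identically. A nonzero \<open>d \<gamma>\<close> then has to
  be cancelled by a term of the other side, which forces \<gamma> into \<open>S\<close>.\<close>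

lemma signomial_eq_imp_coeff_eq:
  assumes "finite S" "finite T" "signomial S c = signomial T d" "\<gamma> \<in> T" "d \<gamma> \<noteq> 0"
  shows "\<gamma> \<in> S \<and> c \<gamma> = d \<gamma>"
proof -
  define e where "e \<alpha> = (if \<alpha> \<in> S then c \<alpha> else 0) - (if \<alpha> \<in> T then d \<alpha> else 0)" for \<alpha>
  have "signomial (S \<union> T) e x = 0" for x
  proof -
    have "signomial (S \<union> T) e x =
        (\<Sum>\<alpha>\<in>S \<union> T. if \<alpha> \<in> S then c \<alpha> * exp (\<alpha> \<bullet> x) else 0)
        - (\<Sum>\<alpha>\<in>S \<union> T. if \<alpha> \<in> T then d \<alpha> * exp (\<alpha> \<bullet> x) else 0)"
      unfolding signomial_def sum_subtractf[symmetric]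
      by (rule sum.cong) (auto simp: e_def algebra_simps)
    also have "\<dots> = signomial S c x - signomial T d x"
      using assms(1,2) unfolding signomial_def
      by (simp add: sum.inter_restrict[symmetric] Int_absorb1 Int_absorb2)
    finally show ?thesis
      using assms(3) by simp
  qed
  then have "e \<gamma> = 0"
    using signomial_eq_zero_imp_coeff_zero[of "S \<union> T" e \<gamma>] assms(1,2,4) by blast
  then show ?thesis
    using assms(4,5) by (auto simp: e_def split: if_splits)
qed

lemma signomial_image:
  assumes "inj_on t S"
  shows "signomial (t ` S) c x = (\<Sum>\<alpha>\<in>S. c (t \<alpha>) * exp (t \<alpha> \<bullet> x))"
  using assms by (simp add: signomial_def sum.reindex)

section \<open>AGE signomials form a convex cone\<close>

lemma age_coneI:
  assumes "\<And>\<alpha>. \<alpha> \<in> A \<Longrightarrow> c \<alpha> \<ge> 0"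
    and "\<And>x. f x = signomial A c x + d * exp (\<beta> \<bullet> x)"
    and "\<And>x. x \<in> K \<Longrightarrow> f x \<ge> 0"
  shows "f \<in> age_cone K A \<beta>"
  using assms unfolding age_cone_def by blast

lemma age_coneE:
  assumes "f \<in> age_cone K A \<beta>"
  obtains c d where "\<And>\<alpha>. \<alpha> \<in> A \<Longrightarrow> c \<alpha> \<ge> 0"
    and "\<And>x. f x = signomial A c x + d * exp (\<beta> \<bullet> x)"
    and "\<And>x. x \<in> K \<Longrightarrow> f x \<ge> 0"
  using assms unfolding age_cone_def by auto

lemma age_cone_zero: "0 \<in> age_cone K A \<beta>"
  by (rule age_coneI[where c = "\<lambda>_. 0" and d = 0]) (auto simp: signomial_def)

lemma age_cone_add:
  assumes "f \<in> age_cone K A \<beta>" "g \<in> age_cone K A \<beta>"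
  shows "f + g \<in> age_cone K A \<beta>"
proof -
  obtain c d where f: "\<And>\<alpha>. \<alpha> \<in> A \<Longrightarrow> c \<alpha> \<ge> 0"
      "\<And>x. f x = signomial A c x + d * exp (\<beta> \<bullet> x)" "\<And>x. x \<in> K \<Longrightarrow> f x \<ge> 0"
    using assms(1) by (rule age_coneE) blast
  obtain c' d' where g: "\<And>\<alpha>. \<alpha> \<in> A \<Longrightarrow> c' \<alpha> \<ge> 0"
      "\<And>x. g x = signomial A c' x + d' * exp (\<beta> \<bullet> x)" "\<And>x. x \<in> K \<Longrightarrow> g x \<ge> 0"
    using assms(2) by (rule age_coneE) blast
  show ?thesis
    by (rule age_coneI[where c = "\<lambda>\<alpha>. c \<alpha> + c' \<alpha>" and d = "d + d'"])
      (simp_all add: f(1,3) g(1,3), simp add: f(2) g(2) signomial_def sum.distrib algebra_simps)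
qed

lemma age_cone_scale:
  assumes "f \<in> age_cone K A \<beta>" "0 \<le> r"
  shows "(\<lambda>x. r * f x) \<in> age_cone K A \<beta>"
proof -
  obtain c d where f: "\<And>\<alpha>. \<alpha> \<in> A \<Longrightarrow> c \<alpha> \<ge> 0"
      "\<And>x. f x = signomial A c x + d * exp (\<beta> \<bullet> x)" "\<And>x. x \<in> K \<Longrightarrow> f x \<ge> 0"
    using assms(1) by (rule age_coneE) blast
  show ?thesis
    by (rule age_coneI[where c = "\<lambda>\<alpha>. r * c \<alpha>" and d = "r * d"])
      (simp_all add: f(1,3) assms(2),
        simp add: f(2) signomial_def sum_distrib_left algebra_simps)
qed

lemma age_cone_sum:
  assumes "\<And>i. i \<in> I \<Longrightarrow> F i \<in> age_cone K A \<beta>"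
  shows "(\<Sum>i\<in>I. F i) \<in> age_cone K A \<beta>"
  using assms
  by (induction I rule: infinite_finite_induct) (auto intro: age_cone_zero age_cone_add)

text \<open>Turns the Minkowski sum into a family \<open>g\<close> indexed by the exponents;
  averaging and relabelling are carried out on such families.\<close>

lemma mem_sage_cone_iff:
  assumes "finite B"
  shows "f \<in> sage_cone K A B \<longleftrightarrow> (\<exists>g. (\<forall>\<beta>\<in>B. g \<beta> \<in> age_cone K A \<beta>) \<and> f = (\<Sum>\<beta>\<in>B. g \<beta>))"
  unfolding sage_cone_def set_sum_alt[OF assms] by blast

section \<open>Actions on variables, exponents and functions\<close>

locale linear_group_action = group G
  for G :: "('g, 'e) monoid_scheme" (structure) +
  fixes \<phi> :: "'g \<Rightarrow> real ^ 'n ^ 'n"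
  assumes hom: "\<phi> \<in> hom G GL"
begin

abbreviation "act_fun \<equiv> fun_act G \<phi>"
abbreviation "act_exp \<equiv> dual_act G \<phi>"

lemma var_act_mult:
  "\<sigma> \<in> carrier G \<Longrightarrow> \<tau> \<in> carrier G \<Longrightarrow> var_act \<phi> (\<sigma> \<otimes> \<tau>) x = var_act \<phi> \<sigma> (var_act \<phi> \<tau> x)"
  using hom_mult[OF hom, of \<sigma> \<tau>] by (simp add: var_act_def GL_def matrix_vector_mul_assoc)

lemma var_act_one: "var_act \<phi> \<one> x = x"
  using hom_one[OF hom is_group group_GL] by (simp add: var_act_def GL_def)

text \<open>This is the defining property of the adjoint. Testing against all \<open>x\<close>
  reduces identities for the dual action to identities for the action on variables.\<close>

lemma inner_dual_act: "act_exp \<sigma> \<alpha> \<bullet> x = \<alpha> \<bullet> var_act \<phi> (inv \<sigma>) x"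
proof -
  have "linear (var_act \<phi> (inv \<sigma>))"
    unfolding var_act_def by simp
  then show ?thesis
    unfolding dual_act_def by (rule adjoint_clauses(2))
qed

text \<open>Inversion and adjunction each reverse products, so together they give a left action
  again.\<close>

lemma dual_act_mult:
  "\<sigma> \<in> carrier G \<Longrightarrow> \<tau> \<in> carrier G \<Longrightarrow> act_exp (\<sigma> \<otimes> \<tau>) \<alpha> = act_exp \<sigma> (act_exp \<tau> \<alpha>)"
  by (rule vector_eq_rdot[THEN iffD1]) (simp add: inner_dual_act var_act_mult inv_mult_group)

lemma dual_act_one: "act_exp \<one> \<alpha> = \<alpha>"
  by (rule vector_eq_rdot[THEN iffD1]) (simp add: inner_dual_act var_act_one)

lemma dual_act_inv_cancel:
  assumes "\<sigma> \<in> carrier G"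
  shows "act_exp (inv \<sigma>) (act_exp \<sigma> \<alpha>) = \<alpha>" "act_exp \<sigma> (act_exp (inv \<sigma>) \<alpha>) = \<alpha>"
  using assms by (simp_all add: dual_act_mult[symmetric] dual_act_one)

lemma inj_dual_act: "\<sigma> \<in> carrier G \<Longrightarrow> inj_on (act_exp \<sigma>) S"
  by (rule inj_on_inverseI[where g = "act_exp (inv \<sigma>)"]) (rule dual_act_inv_cancel)

lemma fun_act_mult:
  "\<sigma> \<in> carrier G \<Longrightarrow> \<tau> \<in> carrier G \<Longrightarrow> act_fun (\<sigma> \<otimes> \<tau>) f = act_fun \<sigma> (act_fun \<tau> f)"
  by (simp add: fun_act_def var_act_mult inv_mult_group)

lemma fun_act_sum: "act_fun \<sigma> (\<Sum>i\<in>I. F i) = (\<Sum>i\<in>I. act_fun \<sigma> (F i))"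
  by (simp add: fun_act_def fun_eq_iff sum_fun_app)

text \<open>Moving the group element across the inner product sends the exponent \<alpha> to
  \<sigma>(\<alpha>) with its coefficient unchanged; as a function of the new exponent, that
  coefficient is read off at the preimage.\<close>

lemma fun_act_signomial:
  assumes "\<sigma> \<in> carrier G"
  shows "act_fun \<sigma> (signomial S c) = signomial (act_exp \<sigma> ` S) (\<lambda>\<alpha>. c (act_exp (inv \<sigma>) \<alpha>))"
proof
  show "act_fun \<sigma> (signomial S c) x = signomial (act_exp \<sigma> ` S) (\<lambda>\<alpha>. c (act_exp (inv \<sigma>) \<alpha>)) x" for x
    using assms
    by (simp add: signomial_image inj_dual_act dual_act_inv_cancel inner_dual_act)
      (simp add: fun_act_def signomial_def)
qed

text \<open>Comparing coefficients in \<sigma>f = f, the coefficient of f at \<sigma>(\<alpha>)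
  equals \<open>c \<alpha>\<close> > 0, which excludes \<sigma>(\<alpha>) from \<open>B\<close>. An
  injective self-map of the finite set \<open>A\<close> is onto.\<close>

lemma positive_exponents_stable:
  assumes "finite A" "finite B" "A \<inter> B = {}"
    and pos: "\<And>\<alpha>. \<alpha> \<in> A \<Longrightarrow> c \<alpha> > 0" and neg: "\<And>\<beta>. \<beta> \<in> B \<Longrightarrow> c \<beta> < 0"
    and \<sigma>: "\<sigma> \<in> carrier G"
    and inv: "act_fun \<sigma> (signomial A c + signomial B c) = signomial A c + signomial B c"
  shows "act_exp \<sigma> ` A = A"
proof -
  have AB: "signomial A c + signomial B c = signomial (A \<union> B) c"
    using assms(1-3) by (simp add: signomial_def fun_eq_iff sum.union_disjoint)
  have "act_exp \<sigma> \<alpha> \<in> A" if \<alpha>: "\<alpha> \<in> A" for \<alpha>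
  proof -
    have "act_exp \<sigma> \<alpha> \<in> A \<union> B \<and> c (act_exp \<sigma> \<alpha>) = c (act_exp (inv \<sigma>) (act_exp \<sigma> \<alpha>))"
    proof (rule signomial_eq_imp_coeff_eq)
      show "signomial (A \<union> B) c = signomial (act_exp \<sigma> ` (A \<union> B)) (\<lambda>\<alpha>. c (act_exp (inv \<sigma>) \<alpha>))"
        using inv unfolding AB fun_act_signomial[OF \<sigma>] by simp
      show "c (act_exp (inv \<sigma>) (act_exp \<sigma> \<alpha>)) \<noteq> 0"
        using pos[OF \<alpha>] by (simp add: dual_act_inv_cancel \<sigma>)
    qed (use assms(1,2) \<alpha> in auto)
    then show ?thesis
      using pos[OF \<alpha>] neg[of "act_exp \<sigma> \<alpha>"] by (auto simp: dual_act_inv_cancel \<sigma>)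
  qed
  then show ?thesis
    by (intro endo_inj_surj assms(1) inj_dual_act \<sigma>) auto
qed

text \<open>Since \<sigma> permutes \<open>A\<close>, the nonnegative coefficients are only
  rearranged and the one free coefficient moves to \<sigma>(\<beta>). Nonnegativity at x in
  \<open>K\<close> is nonnegativity of f at the point of \<open>K\<close> to which the inverse of
  \<sigma> sends x.\<close>

lemma fun_act_age_cone:
  assumes \<sigma>: "\<sigma> \<in> carrier G" and K: "var_act \<phi> (inv \<sigma>) ` K \<subseteq> K"
    and A: "act_exp \<sigma> ` A = A" and f: "f \<in> age_cone K A \<beta>"
  shows "act_fun \<sigma> f \<in> age_cone K A (act_exp \<sigma> \<beta>)"
proof -
  obtain c d where c: "\<And>\<alpha>. \<alpha> \<in> A \<Longrightarrow> c \<alpha> \<ge> 0"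
    and eq: "\<And>x. f x = signomial A c x + d * exp (\<beta> \<bullet> x)"
    and nonneg: "\<And>x. x \<in> K \<Longrightarrow> f x \<ge> 0"
    using f by (rule age_coneE) blast
  show ?thesis
  proof (rule age_coneI)
    show "c (act_exp (inv \<sigma>) \<alpha>) \<ge> 0" if \<alpha>: "\<alpha> \<in> A" for \<alpha>
    proof -
      have "\<alpha> \<in> act_exp \<sigma> ` A"
        using \<alpha> by (simp add: A)
      then obtain \<gamma> where "\<gamma> \<in> A" "\<alpha> = act_exp \<sigma> \<gamma>"
        by blast
      then show ?thesis
        by (simp add: dual_act_inv_cancel \<sigma> c)
    qed
    show "act_fun \<sigma> f x
        = signomial A (\<lambda>\<alpha>. c (act_exp (inv \<sigma>) \<alpha>)) x + d * exp (act_exp \<sigma> \<beta> \<bullet> x)" for x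
    proof -
      have "signomial A c (var_act \<phi> (inv \<sigma>) x) = signomial A (\<lambda>\<alpha>. c (act_exp (inv \<sigma>) \<alpha>)) x"
        using fun_cong[OF fun_act_signomial[OF \<sigma>, of A c], of x] unfolding A fun_act_def .
      then show ?thesis
        unfolding fun_act_def eq inner_dual_act by simp
    qed
    show "act_fun \<sigma> f x \<ge> 0" if "x \<in> K" for x
      using K that nonneg by (auto simp: fun_act_def)
  qed
qed

section \<open>Orbit and coset representatives\<close>

text \<open>If \<open>t\<close> lay in the orbit of a different representative \<open>s\<close>, its
  orbit would already be covered by that of \<open>s\<close>, and discarding \<open>t\<close> would
  contradict minimality.\<close>

lemma orbit_reps_unique:
  assumes reps: "orbit_reps G act_exp S S'" and "s \<in> S'" "t \<in> S'" and st: "t \<in> orbit G act_exp s"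
  shows "s = t"
proof (rule ccontr)
  assume "s \<noteq> t"
  obtain \<sigma> where \<sigma>: "\<sigma> \<in> carrier G" "t = act_exp \<sigma> s"
    using st by (auto simp: orbit_def)
  have "orbit G act_exp t \<subseteq> orbit G act_exp s"
    using \<sigma> by (auto simp: orbit_def dual_act_mult[symmetric])
  then have "(\<Union>u\<in>S' - {t}. orbit G act_exp u) = (\<Union>u\<in>S'. orbit G act_exp u)"
    using \<open>s \<in> S'\<close> \<open>s \<noteq> t\<close> by blast
  moreover have "S' - {t} \<subset> S'"
    using \<open>t \<in> S'\<close> by blast
  ultimately show False
    using reps unfolding orbit_reps_def by metis
qed

text \<open>The orbit-stabilizer correspondence for all orbits at once: for fixed \<beta>, coset
  representatives of the stabilizer enumerate the orbit of \<beta> without repetition, and the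
  orbits of distinct representatives are disjoint.\<close>

lemma bij_betw_orbit_coset_reps:
  assumes reps: "orbit_reps G act_exp B B'"
    and R: "\<And>\<beta>. \<beta> \<in> B' \<Longrightarrow> lcoset_reps G (stabilizer G act_exp \<beta>) (R \<beta>)"
  shows "bij_betw (\<lambda>(\<beta>, \<rho>). act_exp \<rho> \<beta>) (Sigma B' R) B"
proof -
  have R_sub: "\<rho> \<in> carrier G" if "\<beta> \<in> B'" "\<rho> \<in> R \<beta>" for \<beta> \<rho>
    using R[OF that(1)] that(2) by (auto simp: lcoset_reps_def)
  \<comment> \<open>A left coset of the stabilizer is a fibre of the orbit map at \<beta>, so
    choosing one element per coset means choosing one per orbit point.\<close>
  have coset: "\<sigma> <# stabilizer G act_exp \<beta> = {\<tau> \<in> carrier G. act_exp \<tau> \<beta> = act_exp \<sigma> \<beta>}"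
    if \<sigma>: "\<sigma> \<in> carrier G" for \<sigma> \<beta>
  proof (intro equalityI subsetI)
    show "\<tau> \<in> {\<tau> \<in> carrier G. act_exp \<tau> \<beta> = act_exp \<sigma> \<beta>}" if "\<tau> \<in> \<sigma> <# stabilizer G act_exp \<beta>" for \<tau>
      using that \<sigma> by (auto simp: l_coset_def stabilizer_def dual_act_mult)
    show "\<tau> \<in> \<sigma> <# stabilizer G act_exp \<beta>" if "\<tau> \<in> {\<tau> \<in> carrier G. act_exp \<tau> \<beta> = act_exp \<sigma> \<beta>}" for \<tau>
    proof -
      have "inv \<sigma> \<otimes> \<tau> \<in> stabilizer G act_exp \<beta>"
        using that \<sigma> by (simp add: stabilizer_def dual_act_mult dual_act_inv_cancel)
      moreover have "\<tau> = \<sigma> \<otimes> (inv \<sigma> \<otimes> \<tau>)"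
        using that \<sigma> by (simp add: m_assoc[symmetric])
      ultimately show ?thesis
        unfolding l_coset_def by blast
    qed
  qed
  have unique: "\<exists>!\<rho>. \<rho> \<in> R \<beta> \<and> act_exp \<rho> \<beta> = act_exp \<sigma> \<beta>"
    if "\<beta> \<in> B'" "\<sigma> \<in> carrier G" for \<beta> \<sigma>
  proof -
    have "\<sigma> <# stabilizer G act_exp \<beta> \<in> lcosets (stabilizer G act_exp \<beta>)"
      using that(2) by (auto simp: LCOSETS_def)
    then have "\<exists>!\<rho>. \<rho> \<in> R \<beta> \<inter> (\<sigma> <# stabilizer G act_exp \<beta>)"
      using R[OF that(1)] unfolding lcoset_reps_def by blast
    moreover have "R \<beta> \<inter> (\<sigma> <# stabilizer G act_exp \<beta>) = {\<rho> \<in> R \<beta>. act_exp \<rho> \<beta> = act_exp \<sigma> \<beta>}"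
      using R_sub[OF that(1)] unfolding coset[OF that(2)] by blast
    ultimately show ?thesis by simp
  qed
  have B: "(\<Union>s\<in>B'. orbit G act_exp s) = B"
    using reps by (simp add: orbit_reps_def)
  show ?thesis
    unfolding bij_betw_def
  proof (intro conjI inj_onI equalityI subsetI)
    fix p q
    assume p: "p \<in> Sigma B' R" and q: "q \<in> Sigma B' R"
      and eq: "(case p of (\<beta>, \<rho>) \<Rightarrow> act_exp \<rho> \<beta>) = (case q of (\<beta>, \<rho>) \<Rightarrow> act_exp \<rho> \<beta>)"
    obtain \<beta> \<rho> \<gamma> \<tau> where pq: "p = (\<beta>, \<rho>)" "q = (\<gamma>, \<tau>)"
      by fastforce
    have \<rho>: "\<beta> \<in> B'" "\<rho> \<in> R \<beta>" "\<rho> \<in> carrier G" and \<tau>: "\<gamma> \<in> B'" "\<tau> \<in> R \<gamma>" "\<tau> \<in> carrier G"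
      using p q pq R_sub by auto
    \<comment> \<open>Equal images \<rho>(\<beta>) = \<tau>(\<gamma>) put both representatives in
      one orbit; after \<beta> = \<gamma>, uniqueness within the coset gives \<rho> =
      \<tau>.\<close>
    have "\<gamma> = act_exp (inv \<tau> \<otimes> \<rho>) \<beta>"
      using eq \<rho> \<tau> by (simp add: pq dual_act_mult dual_act_inv_cancel)
    then have "\<gamma> \<in> orbit G act_exp \<beta>"
      using \<rho>(3) \<tau>(3) unfolding orbit_def by blast
    then have "\<beta> = \<gamma>"
      using orbit_reps_unique[OF reps \<rho>(1) \<tau>(1)] by blast
    then show "p = q"
      using unique[OF \<rho>(1,3)] \<rho> \<tau> eq by (auto simp: pq)
  next
    fix b
    assume "b \<in> (\<lambda>(\<beta>, \<rho>). act_exp \<rho> \<beta>) ` Sigma B' R"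
    then show "b \<in> B"
      using R_sub by (fastforce simp: B[symmetric] orbit_def)
  next
    fix b
    assume "b \<in> B"
    then obtain \<beta> \<sigma> where "\<beta> \<in> B'" "\<sigma> \<in> carrier G" "b = act_exp \<sigma> \<beta>"
      unfolding B[symmetric] orbit_def by blast
    moreover from this obtain \<rho> where "\<rho> \<in> R \<beta>" "act_exp \<rho> \<beta> = act_exp \<sigma> \<beta>"
      using unique by blast
    ultimately show "b \<in> (\<lambda>(\<beta>, \<rho>). act_exp \<rho> \<beta>) ` Sigma B' R"
      by (auto intro!: image_eqI[where x = "(\<beta>, \<rho>)"])
  qed
qed

text \<open>Reindexes along the bijection above. Both directions of the theorem use it with
  function-valued \<open>k\<close>.\<close>

lemma sum_over_orbit_reps:
  assumes "finite B" "finite (carrier G)" and reps: "orbit_reps G act_exp B B'"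
    and R: "\<And>\<beta>. \<beta> \<in> B' \<Longrightarrow> lcoset_reps G (stabilizer G act_exp \<beta>) (R \<beta>)"
  shows "(\<Sum>\<beta>\<in>B. k \<beta>) = (\<Sum>\<beta>\<in>B'. \<Sum>\<rho>\<in>R \<beta>. k (act_exp \<rho> \<beta>))"
proof -
  have "finite B'"
    using reps assms(1) finite_subset by (auto simp: orbit_reps_def)
  moreover have "finite (R \<beta>)" if "\<beta> \<in> B'" for \<beta>
    using R[OF that] assms(2) finite_subset by (auto simp: lcoset_reps_def)
  ultimately show ?thesis
    using sum.reindex_bij_betw[OF bij_betw_orbit_coset_reps[OF reps R], of k]
    by (simp add: sum.Sigma split_def)
qed

section \<open>Averaging a decomposition over the group\<close>

lemma sum_carrier_mult:
  assumes "\<tau> \<in> carrier G"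
  shows "(\<Sum>\<sigma>\<in>carrier G. F (\<tau> \<otimes> \<sigma>)) = (\<Sum>\<sigma>\<in>carrier G. F \<sigma>)"
proof (rule sum.reindex_bij_betw)
  show "bij_betw ((\<otimes>) \<tau>) (carrier G) (carrier G)"
    using assms by (simp add: bij_betw_def inj_on_cmult surj_const_mult)
qed

text \<open>A Reynolds operator acting on whole families rather than on single functions: the member
  at the inverse translate of \<beta> is carried back by \<sigma>, so every summand belongs to the
  same exponent \<beta>.\<close>

definition orbit_average :: "(real ^ 'n \<Rightarrow> real ^ 'n \<Rightarrow> real) \<Rightarrow> real ^ 'n \<Rightarrow> real ^ 'n \<Rightarrow> real"
  where "orbit_average g \<beta> =
    (\<lambda>x. inverse (real (order G)) * (\<Sum>\<sigma>\<in>carrier G. act_fun \<sigma> (g (act_exp (inv \<sigma>) \<beta>))) x)"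

text \<open>Equivariance serves two purposes: for stabilizer elements it gives invariance, and for
  coset representatives it produces the terms \<rho> h of the decomposition.\<close>

lemma fun_act_orbit_average:
  assumes \<tau>: "\<tau> \<in> carrier G"
  shows "act_fun \<tau> (orbit_average g \<beta>) = orbit_average g (act_exp \<tau> \<beta>)"
proof -
  have "act_fun \<tau> (\<Sum>\<sigma>\<in>carrier G. act_fun \<sigma> (g (act_exp (inv \<sigma>) \<beta>)))
      = (\<Sum>\<sigma>\<in>carrier G. act_fun (\<tau> \<otimes> \<sigma>) (g (act_exp (inv (\<tau> \<otimes> \<sigma>)) (act_exp \<tau> \<beta>))))"
    unfolding fun_act_sum
    by (rule sum.cong)
      (simp_all add: \<tau> fun_act_mult dual_act_mult inv_mult_group dual_act_inv_cancel)
  also have "\<dots> = (\<Sum>\<sigma>\<in>carrier G. act_fun \<sigma> (g (act_exp (inv \<sigma>) (act_exp \<tau> \<beta>))))"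
    by (rule sum_carrier_mult[OF \<tau>])
  finally show ?thesis
    unfolding orbit_average_def by (simp add: fun_act_def fun_eq_iff)
qed

lemma orbit_average_age_cone:
  assumes "\<And>\<sigma>. \<sigma> \<in> carrier G \<Longrightarrow> var_act \<phi> \<sigma> ` K = K"
    and "\<And>\<sigma>. \<sigma> \<in> carrier G \<Longrightarrow> act_exp \<sigma> ` A = A"
    and "\<And>\<sigma>. \<sigma> \<in> carrier G \<Longrightarrow> g (act_exp \<sigma> \<beta>) \<in> age_cone K A (act_exp \<sigma> \<beta>)"
  shows "orbit_average g \<beta> \<in> age_cone K A \<beta>"
  unfolding orbit_average_def
proof (intro age_cone_scale age_cone_sum)
  fix \<sigma> assume \<sigma>: "\<sigma> \<in> carrier G"
  have "act_fun \<sigma> (g (act_exp (inv \<sigma>) \<beta>)) \<in> age_cone K A (act_exp \<sigma> (act_exp (inv \<sigma>) \<beta>))"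
    using assms \<sigma> by (intro fun_act_age_cone) auto
  then show "act_fun \<sigma> (g (act_exp (inv \<sigma>) \<beta>)) \<in> age_cone K A \<beta>"
    by (simp add: dual_act_inv_cancel \<sigma>)
qed simp

text \<open>For fixed \<sigma>, summing over \<open>B\<close> first and reindexing by the inverse of
  \<sigma> gives \<sigma> applied to the invariant total, hence the total itself. The sum over the
  group is then \<open>order G\<close> copies of it, which the normalization cancels.\<close>

lemma sum_orbit_average:
  assumes fin: "finite (carrier G)"
    and B: "\<And>\<sigma>. \<sigma> \<in> carrier G \<Longrightarrow> act_exp \<sigma> ` B = B"
    and inv: "\<And>\<sigma>. \<sigma> \<in> carrier G \<Longrightarrow> act_fun \<sigma> (\<Sum>\<beta>\<in>B. g \<beta>) = (\<Sum>\<beta>\<in>B. g \<beta>)"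
  shows "(\<Sum>\<beta>\<in>B. orbit_average g \<beta>) = (\<Sum>\<beta>\<in>B. g \<beta>)"
proof -
  have eq: "(\<Sum>\<beta>\<in>B. act_fun \<sigma> (g (act_exp (inv \<sigma>) \<beta>))) = (\<Sum>\<beta>\<in>B. g \<beta>)"
    if \<sigma>: "\<sigma> \<in> carrier G" for \<sigma>
  proof -
    have "bij_betw (act_exp (inv \<sigma>)) B B"
      using \<sigma> by (simp add: bij_betw_def inj_dual_act B)
    from sum.reindex_bij_betw[OF this, of "\<lambda>\<beta>. act_fun \<sigma> (g \<beta>)"]
    show ?thesis
      using inv[OF \<sigma>] by (simp add: fun_act_sum)
  qed
  have "order G \<noteq> 0"
    using fin order_gt_0_iff_finite by simp
  then show ?thesis
    by (simp add: orbit_average_def fun_eq_iff sum_fun_app sum_distrib_left[symmetric]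
        sum.swap[of _ "carrier G"] fun_cong[OF eq, unfolded sum_fun_app] order_def)
qed

end

theorem theorem3p1:
  fixes G :: "('g, 'e) monoid_scheme"
    and \<phi> :: "'g \<Rightarrow> real ^ 'n ^ 'n"
    and K A B B' :: "(real ^ 'n) set"
    and c :: "real ^ 'n \<Rightarrow> real"
    and f :: "real ^ 'n \<Rightarrow> real"
    and R :: "real ^ 'n \<Rightarrow> 'g set"
  assumes "group G" and "finite (carrier G)"
    and "\<phi> \<in> hom G GL"
    and "convex K"
    and "\<And>\<sigma>. \<sigma> \<in> carrier G \<Longrightarrow> var_act \<phi> \<sigma> ` K = K"
    and "finite A" and "A \<noteq> {}" and "finite B" and "A \<inter> B = {}"
    and "\<And>\<alpha>. \<alpha> \<in> A \<Longrightarrow> c \<alpha> > 0"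
    and "\<And>\<beta>. \<beta> \<in> B \<Longrightarrow> c \<beta> < 0"
    and "f = signomial A c + signomial B c"
    and "\<And>\<sigma>. \<sigma> \<in> carrier G \<Longrightarrow> fun_act G \<phi> \<sigma> f = f"
    and "orbit_reps G (dual_act G \<phi>) B B'"
    and "\<And>\<beta>. \<beta> \<in> B' \<Longrightarrow> lcoset_reps G (stabilizer G (dual_act G \<phi>) \<beta>) (R \<beta>)"
  shows "(f \<in> sage_cone K A B \<longleftrightarrow>
           (\<exists>h. (\<forall>\<beta>\<in>B'. h \<beta> \<in> age_cone K A \<beta>) \<and>
                f = (\<Sum>\<beta>\<in>B'. \<Sum>\<rho>\<in>R \<beta>. fun_act G \<phi> \<rho> (h \<beta>)))) \<and>
         (f \<in> sage_cone K A B \<longrightarrow>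
           (\<exists>h. (\<forall>\<beta>\<in>B'. h \<beta> \<in> age_cone K A \<beta> \<and>
                   (\<forall>\<sigma>\<in>stabilizer G (dual_act G \<phi>) \<beta>. fun_act G \<phi> \<sigma> (h \<beta>) = h \<beta>)) \<and>
                f = (\<Sum>\<beta>\<in>B'. \<Sum>\<rho>\<in>R \<beta>. fun_act G \<phi> \<rho> (h \<beta>))))"
proof -
  interpret linear_group_action G \<phi>
    using assms(1,3) by (simp add: linear_group_action_def linear_group_action_axioms_def)
  note K = assms(5)
  note fin = assms(2,6,8)
  note reps = assms(14,15)
  have A: "act_exp \<sigma> ` A = A" if "\<sigma> \<in> carrier G" for \<sigma>
    using positive_exponents_stable[of A B c \<sigma>] assms that by auto
  have orb: "(\<Union>s\<in>B'. orbit G act_exp s) = B"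
    using assms(14) by (simp add: orbit_reps_def)
  \<comment> \<open>Stability of \<open>B\<close> follows from its being a union of orbits, whereas
    that of \<open>A\<close> came from comparing coefficients.\<close>
  have B_in: "act_exp \<sigma> \<beta> \<in> B" if "\<sigma> \<in> carrier G" "\<beta> \<in> B" for \<sigma> \<beta>
    using that unfolding orb[symmetric] orbit_def
    by (auto simp: dual_act_mult[symmetric]) (metis m_closed)
  have B: "act_exp \<sigma> ` B = B" if "\<sigma> \<in> carrier G" for \<sigma>
    using that B_in by (intro endo_inj_surj fin inj_dual_act) auto
  have B': "B' \<subseteq> B"
    using assms(14) by (simp add: orbit_reps_def)
  have R_sub: "R \<beta> \<subseteq> carrier G" if "\<beta> \<in> B'" for \<beta>
    using assms(15)[OF that] by (simp add: lcoset_reps_def)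
  have symmetric: "\<exists>h. (\<forall>\<beta>\<in>B'. h \<beta> \<in> age_cone K A \<beta> \<and>
        (\<forall>\<sigma>\<in>stabilizer G (act_exp) \<beta>. act_fun \<sigma> (h \<beta>) = h \<beta>)) \<and>
      f = (\<Sum>\<beta>\<in>B'. \<Sum>\<rho>\<in>R \<beta>. act_fun \<rho> (h \<beta>))" if sage: "f \<in> sage_cone K A B"
  proof -
    obtain g where g: "\<forall>\<beta>\<in>B. g \<beta> \<in> age_cone K A \<beta>" and f: "f = (\<Sum>\<beta>\<in>B. g \<beta>)"
      using sage unfolding mem_sage_cone_iff[OF fin(3)] by blast
    have "f = (\<Sum>\<beta>\<in>B. orbit_average g \<beta>)"
      unfolding f using assms(13) by (intro sum_orbit_average[symmetric] fin B) (simp_all add: f)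
    also have "\<dots> = (\<Sum>\<beta>\<in>B'. \<Sum>\<rho>\<in>R \<beta>. orbit_average g (act_exp \<rho> \<beta>))"
      by (rule sum_over_orbit_reps[OF fin(3,1) reps])
    also have "\<dots> = (\<Sum>\<beta>\<in>B'. \<Sum>\<rho>\<in>R \<beta>. act_fun \<rho> (orbit_average g \<beta>))"
      using R_sub by (intro sum.cong refl fun_act_orbit_average[symmetric]) blast
    finally have "f = (\<Sum>\<beta>\<in>B'. \<Sum>\<rho>\<in>R \<beta>. act_fun \<rho> (orbit_average g \<beta>))" .
    moreover have "orbit_average g \<beta> \<in> age_cone K A \<beta>" if "\<beta> \<in> B'" for \<beta>
      using that B' B_in g K A by (intro orbit_average_age_cone) auto
    \<comment> \<open>The averaged family restricted to the representatives serves as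
      \<open>h\<close>. A stabilizer element fixes \<beta>, so equivariance makes it fix
      \<open>h \<beta>\<close>.\<close>
    ultimately show ?thesis
      by (intro exI[of _ "orbit_average g"]) (auto simp: stabilizer_def fun_act_orbit_average)
  qed
  have converse: "f \<in> sage_cone K A B"
    if h: "\<forall>\<beta>\<in>B'. h \<beta> \<in> age_cone K A \<beta>"
      and f: "f = (\<Sum>\<beta>\<in>B'. \<Sum>\<rho>\<in>R \<beta>. act_fun \<rho> (h \<beta>))" for h
  proof -
    define P where "P = (\<lambda>(\<beta>, \<rho>). act_exp \<rho> \<beta>)"
    \<comment> \<open>Each term \<rho> h is relabelled by the exponent \<rho>(\<beta>) to which it
      belongs; bijectivity of \<open>P\<close> makes the pair behind each \<open>b\<close> in
      \<open>B\<close> unique.\<close>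
    define k where "k b = (case inv_into (Sigma B' R) P b of (\<beta>, \<rho>) \<Rightarrow> act_fun \<rho> (h \<beta>))" for b
    have bij: "bij_betw P (Sigma B' R) B"
      unfolding P_def by (rule bij_betw_orbit_coset_reps[OF reps])
    have k: "k (act_exp \<rho> \<beta>) = act_fun \<rho> (h \<beta>)" if "\<beta> \<in> B'" "\<rho> \<in> R \<beta>" for \<beta> \<rho>
      using inv_into_f_f[OF bij_betw_imp_inj_on[OF bij], of "(\<beta>, \<rho>)"] that
      by (simp add: k_def P_def)
    have "f = (\<Sum>\<beta>\<in>B'. \<Sum>\<rho>\<in>R \<beta>. k (act_exp \<rho> \<beta>))"
      unfolding f by (simp add: k cong: sum.cong)
    also have "\<dots> = (\<Sum>\<beta>\<in>B. k \<beta>)"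
      by (rule sum_over_orbit_reps[OF fin(3,1) reps, symmetric])
    finally have "f = (\<Sum>\<beta>\<in>B. k \<beta>)" .
    moreover have "k b \<in> age_cone K A b" if b: "b \<in> B" for b
    proof -
      obtain \<beta> \<rho> where *: "\<beta> \<in> B'" "\<rho> \<in> R \<beta>" "b = act_exp \<rho> \<beta>"
        using b bij_betw_imp_surj_on[OF bij] by (force simp: P_def)
      then have "\<rho> \<in> carrier G"
        using R_sub by blast
      then have "act_fun \<rho> (h \<beta>) \<in> age_cone K A (act_exp \<rho> \<beta>)"
        using h K A *(1) by (intro fun_act_age_cone) simp_all
      then show ?thesis
        by (simp add: * k)
    qed
    ultimately show ?thesis
      unfolding mem_sage_cone_iff[OF fin(3)] by blast
  qed
  show ?thesis
    \<comment> \<open>Forgetting the stabilizer invariance in \<open>symmetric\<close> yields the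
      forward half of the equivalence.\<close>
    using symmetric converse by blast
qed

end
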